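(* Let $\alpha\in[0,\infty)$ and assume: (i) $\mathcal{H}\subseteq\mathbb{R}^n\times\mathbb{R}^{m\times n}\times\mathbb{R}^m$ is compact, convex and columnwise, i.e. $\mathcal{H}=\mathcal{H}_1\times\dots\times\mathcal{H}_n\times\mathcal{H}_{n+1}$, meaning that $(c,A,b)\in\mathcal{H}$ if and only if $(c_j,A_j)\in\mathcal{H}_j\subseteq\mathbb{R}^{m+1}$ for all $j\in\{1,\dots,n\}$ and $b\in\mathcal{H}_{n+1}\subseteq\mathbb{R}^m$, where all sets $\mathcal{H}_1,\dots,\mathcal{H}_{n+1}$ are bounded and convex; (ii) $\mathcal{D}(\hat x)\subseteq\mathbb{R}^n$ is compact and convex. Consider the set of all $(x,c,A,b)$ with $$c^\top x\le\alpha\,\hat c^\top\hat x,\quad Ax\ge b,\quad x\in\mathcal{D}(\hat x),\quad (c,A,b)\in\mathcal{H},\quad x\ge0$$ (the feasible region of RCEP). Then the image of this set under the variable transformation $(x,c,A,b)\mapsto(x,w,U,b)$, with $w_j=c_jx_j$ and $u_{ij}=a_{ij}x_j$ for all $j\in\{1,\dots,n\}$, $i\in\{1,\dots,m\}$, is convex and equals $$\mathcal{P}=\big\{(x,w,U,b):\ \mathbf{1}^\top w\le\alpha\,\hat c^\top\hat x,\ \ U\mathbf{1}\ge b,\ \ x\in\mathcal{D}(\hat x),\ \ (w_j,U_j)\in x_j\mathcal{H}_j\ \forall j\in\{1,\dots,n\},\ \ b\in\mathcal{H}_{n+1},\ \ x\ge0\big\},$$ where $x_j\mathcal{H}_j:=\{x_jh:\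 h\in\mathcal{H}_j\}$.
   Context: Setting: the present problem is the linear program $\min\{\hat c^\top x:\ \hat A x\ge \hat b,\ x\ge 0\}$ with $\hat c\in\mathbb{R}^n$, $\hat A\in\mathbb{R}^{m\times n}$, $\hat b\in\mathbb{R}^m$, assumed feasible, with optimal solution $\hat x$ and $\hat c^\top\hat x\ge0$; $(\hat c,\hat A,\hat b)\in\mathcal{H}$. The set $\mathcal{H}$ (mutable parameter space) is the set of admissible parameter triples $(c,A,b)$, and $\mathcal{D}(\hat x)$ is the favored solution space. Here $A=(a_{ij})$, $A_j$ and $U_j$ denote the $j$-th columns of $A,U\in\mathbb{R}^{m\times n}$, $w\in\mathbb{R}^n$, $\mathbf{1}\in\mathbb{R}^n$ is the all-ones vector, and vector inequalities are componentwise. RCEP (the relative counterfactual explanation problem) is the problem of minimizing a distance $\delta((c,A,b),(\hat c,\hat A,\hat b))$ over the displayed feasible region; the distance does not enter the claim. *)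

theory Defs
  imports "HOL-Analysis.Analysis"
begin

text \<open>
  The index types \<open>'n\<close> and \<open>'m\<close> play the roles of \<open>{1..n}\<close> and \<open>{1..m}\<close>. The order on
  vectors is the componentwise one of the library, and \<open>1\<close> is the all-ones vector.
  The space of dimension \<open>m + 1\<close> containing the pairs \<open>(c\<^sub>j, A\<^sub>j)\<close> is \<open>real \<times> (real ^ 'm)\<close>.
\<close>

type_synonym ('n, 'm) params = "(real ^ 'n) \<times> (real ^ 'n ^ 'm) \<times> (real ^ 'm)"

definition lp_feasible :: "real ^ 'n ^ 'm \<Rightarrow> real ^ 'm \<Rightarrow> (real ^ 'n) set" where
  "lp_feasible A b = {x. A *v x \<ge> b \<and> x \<ge> 0}"

definition lp_optimal :: "real ^ 'n \<Rightarrow> real ^ 'n ^ 'm \<Rightarrow> real ^ 'm \<Rightarrow> real ^ 'n \<Rightarrow> bool" where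
  "lp_optimal c A b x \<longleftrightarrow>
     x \<in> lp_feasible A b \<and> (\<forall>y \<in> lp_feasible A b. c \<bullet> x \<le> c \<bullet> y)"

definition columnwise ::
  "('n::finite, 'm::finite) params set \<Rightarrow> ('n \<Rightarrow> (real \<times> (real ^ 'm)) set) \<Rightarrow> (real ^ 'm) set \<Rightarrow> bool" where
  "columnwise H Hcol Hrhs \<longleftrightarrow>
     (\<forall>c A b. (c, A, b) \<in> H \<longleftrightarrow> (\<forall>j. (c $ j, column j A) \<in> Hcol j) \<and> b \<in> Hrhs) \<and>
     (\<forall>j. bounded (Hcol j) \<and> convex (Hcol j)) \<and> bounded Hrhs \<and> convex Hrhs"

definition rcep_feasible ::
  "real \<Rightarrow> real ^ 'n \<Rightarrow> real ^ 'n \<Rightarrow> (real ^ 'n \<Rightarrow> (real ^ 'n) set) \<Rightarrow> ('n, 'm) params set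
    \<Rightarrow> ((real ^ 'n) \<times> (real ^ 'n) \<times> (real ^ 'n ^ 'm) \<times> (real ^ 'm)) set" where
  "rcep_feasible \<alpha> chat xhat D H =
     {(x, c, A, b). c \<bullet> x \<le> \<alpha> * (chat \<bullet> xhat) \<and> A *v x \<ge> b \<and> x \<in> D xhat
        \<and> (c, A, b) \<in> H \<and> x \<ge> 0}"

definition var_transform ::
  "(real ^ 'n) \<times> (real ^ 'n) \<times> (real ^ 'n ^ 'm) \<times> (real ^ 'm)
    \<Rightarrow> (real ^ 'n) \<times> (real ^ 'n) \<times> (real ^ 'n ^ 'm) \<times> (real ^ 'm)" where
  "var_transform = (\<lambda>(x, c, A, b). (x, \<chi> j. c $ j * x $ j, \<chi> i j. A $ i $ j * x $ j, b))"

definition transformed_region ::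
  "real \<Rightarrow> real ^ 'n \<Rightarrow> real ^ 'n \<Rightarrow> (real ^ 'n \<Rightarrow> (real ^ 'n) set)
    \<Rightarrow> ('n \<Rightarrow> (real \<times> (real ^ 'm)) set) \<Rightarrow> (real ^ 'm) set
    \<Rightarrow> ((real ^ 'n) \<times> (real ^ 'n) \<times> (real ^ 'n ^ 'm) \<times> (real ^ 'm)) set" where
  "transformed_region \<alpha> chat xhat D Hcol Hrhs =
     {(x, w, U, b). 1 \<bullet> w \<le> \<alpha> * (chat \<bullet> xhat) \<and> U *v 1 \<ge> b \<and> x \<in> D xhat
        \<and> (\<forall>j. (w $ j, column j U) \<in> (\<lambda>h. x $ j *\<^sub>R h) ` Hcol j) \<and> b \<in> Hrhs \<and> x \<ge> 0}"

end

theory Submission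
  imports Defs
begin

text \<open>
  Multiplying column \<open>j\<close> of the data by \<open>x\<^sub>j \<ge> 0\<close> makes the bilinear constraints linear, and turns
  \<open>(c\<^sub>j, A\<^sub>j) \<in> H\<^sub>j\<close> into membership of \<open>(x\<^sub>j, w\<^sub>j, U\<^sub>j)\<close> in the cone over \<open>{1} \<times> H\<^sub>j\<close>, which is convex.
  The columns of a preimage can be chosen independently, one from each \<open>H\<^sub>j\<close>, because \<open>H\<close> is a
  product; where \<open>x\<^sub>j = 0\<close> every element of \<open>H\<^sub>j\<close> will do.
\<close>

text \<open>With \<open>r = u * s + v * t\<close>, the combination of \<open>s *\<^sub>R g\<close>
  and \<open>t *\<^sub>R h\<close> is \<open>r\<close> times the average of \<open>g\<close> and
  \<open>h\<close> with weights \<open>u * s / r\<close> and \<open>v * t / r\<close>, and this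
  average stays in \<open>S\<close>.\<close>

lemma convex_cone_over:
  fixes S :: "'a::real_vector set"
  assumes "convex S"
  shows "convex {(t, v). 0 \<le> t \<and> v \<in> (\<lambda>h. t *\<^sub>R h) ` S}"
proof (rule convexI)
  fix p q :: "real \<times> 'a" and u v :: real
  assume "p \<in> {(t, v). 0 \<le> t \<and> v \<in> (\<lambda>h. t *\<^sub>R h) ` S}"
    and "q \<in> {(t, v). 0 \<le> t \<and> v \<in> (\<lambda>h. t *\<^sub>R h) ` S}"
    and uv: "0 \<le> u" "0 \<le> v" "u + v = 1"
  then obtain s g t h where p: "p = (s, s *\<^sub>R g)" "0 \<le> s" "g \<in> S"
    and q: "q = (t, t *\<^sub>R h)" "0 \<le> t" "h \<in> S"
    by auto
  define r where "r = u * s + v * t"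
  have nonneg: "0 \<le> u * s" "0 \<le> v * t"
    using uv p q by auto
  have "\<exists>k\<in>S. (u * s) *\<^sub>R g + (v * t) *\<^sub>R h = r *\<^sub>R k"
  \<comment> \<open>If \<open>r = 0\<close>, both nonnegative summands of \<open>r\<close> vanish
    and any point of \<open>S\<close> serves, for instance \<open>g\<close>. Otherwise dividing by
    \<open>r\<close> gives weights that sum to 1.\<close>
  proof (cases "r = 0")
    case True
    then have "u * s = 0" "v * t = 0"
      using nonneg unfolding r_def by linarith+
    then show ?thesis
      using True p by auto
  next
    case False
    have "u * s / r + v * t / r = 1"
      using False by (simp add: r_def flip: add_divide_distrib)
    then have "(u * s / r) *\<^sub>R g + (v * t / r) *\<^sub>R h \<in> S"
      using assms p q nonneg by (intro convexD) (auto simp: r_def)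
    then show ?thesis
      by (rule rev_bexI) (use False in \<open>simp add: scaleR_right_distrib\<close>)
  qed
  then show "u *\<^sub>R p + v *\<^sub>R q \<in> {(t, v). 0 \<le> t \<and> v \<in> (\<lambda>h. t *\<^sub>R h) ` S}"
    using nonneg by (auto simp: p q r_def)
qed

lemma column_add: "column j (A + B) = column j A + column j B"
  by (simp add: column_def vec_eq_iff)

lemma column_scaleR: "column j (r *\<^sub>R A) = r *\<^sub>R column j A"
  by (simp add: column_def vec_eq_iff)

lemma convex_transformed_region:
  fixes D :: "real ^ 'n \<Rightarrow> (real ^ 'n) set"
    and Hcol :: "'n \<Rightarrow> (real \<times> (real ^ 'm)) set"
  assumes "convex (D xhat)" and "\<And>j. convex (Hcol j)" and "convex Hrhs"
  shows "convex (transformed_region \<alpha> chat xhat D Hcol Hrhs)"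
proof (rule convexI)
  fix p q :: "(real ^ 'n) \<times> (real ^ 'n) \<times> (real ^ 'n ^ 'm) \<times> (real ^ 'm)" and u v :: real
  assume pq: "p \<in> transformed_region \<alpha> chat xhat D Hcol Hrhs"
    "q \<in> transformed_region \<alpha> chat xhat D Hcol Hrhs"
    and uv: "0 \<le> u" "0 \<le> v" "u + v = 1"
  obtain x w U b where p: "p = (x, w, U, b)"
    by (cases p)
  obtain y z V d where q: "q = (y, z, V, d)"
    by (cases q)
  \<comment> \<open>The factor \<open>x $ j\<close> changes along the segment from \<open>p\<close>
    to \<open>q\<close>, so convexity of each \<open>Hcol j\<close> under a fixed scaling would not
    suffice. Keeping the factor as a coordinate yields one convex set for both endpoints.\<close>
  let ?K = "\<lambda>j. {(t, v). 0 \<le> t \<and> v \<in> (\<lambda>h. t *\<^sub>R h) ` Hcol j}"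
  have P: "1 \<bullet> w \<le> \<alpha> * (chat \<bullet> xhat)" "b \<le> U *v 1" "x \<in> D xhat" "b \<in> Hrhs" "0 \<le> x"
    "\<And>j. (x $ j, w $ j, column j U) \<in> ?K j"
    and Q: "1 \<bullet> z \<le> \<alpha> * (chat \<bullet> xhat)" "d \<le> V *v 1" "y \<in> D xhat" "d \<in> Hrhs" "0 \<le> y"
    "\<And>j. (y $ j, z $ j, column j V) \<in> ?K j"
    using pq by (auto simp: p q transformed_region_def less_eq_vec_def)
  have "1 \<bullet> (u *\<^sub>R w + v *\<^sub>R z) \<le> \<alpha> * (chat \<bullet> xhat)"
    using convex_bound_le[OF P(1) Q(1) uv] by (simp add: inner_add_right)
  moreover have "u *\<^sub>R b + v *\<^sub>R d \<le> (u *\<^sub>R U + v *\<^sub>R V) *v 1"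
  proof -
    have "u *\<^sub>R b + v *\<^sub>R d \<le> u *\<^sub>R (U *v 1) + v *\<^sub>R (V *v 1)"
      using P(2) Q(2) uv by (auto simp: less_eq_vec_def intro!: add_mono mult_left_mono)
    then show ?thesis
      by (simp add: matrix_vector_mult_add_rdistrib scaleR_matrix_vector_assoc)
  qed
  moreover have "u *\<^sub>R x + v *\<^sub>R y \<in> D xhat" "u *\<^sub>R b + v *\<^sub>R d \<in> Hrhs"
    using assms P(3,4) Q(3,4) uv by (auto intro: convexD)
  moreover have "0 \<le> u *\<^sub>R x + v *\<^sub>R y"
    using P(5) Q(5) uv by (auto simp: less_eq_vec_def)
  moreover have "((u *\<^sub>R w + v *\<^sub>R z) $ j, column j (u *\<^sub>R U + v *\<^sub>R V))
      \<in> (\<lambda>h. (u *\<^sub>R x + v *\<^sub>R y) $ j *\<^sub>R h) ` Hcol j" for j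
    using convexD[OF convex_cone_over[OF assms(2)] P(6) Q(6) uv, of j]
    by (auto simp: column_add column_scaleR)
  ultimately show "u *\<^sub>R p + v *\<^sub>R q \<in> transformed_region \<alpha> chat xhat D Hcol Hrhs"
    by (auto simp: p q transformed_region_def)
qed

lemma var_transform_rcep_feasible:
  fixes H :: "('n::finite, 'm::finite) params set"
  assumes "columnwise H Hcol Hrhs"
  shows "var_transform ` rcep_feasible \<alpha> chat xhat D H
    = transformed_region \<alpha> chat xhat D Hcol Hrhs"
proof -
  have H: "(c, A, b) \<in> H \<longleftrightarrow> (\<forall>j. (c $ j, column j A) \<in> Hcol j) \<and> b \<in> Hrhs" for c A b
    using assms by (simp add: columnwise_def)
  \<comment> \<open>The next three identities match the constraints of the two regions one by one.
    By \<open>col\<close>, the forward inclusion takes \<open>(c $ j, column j A)\<close> itself as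
    the element of \<open>Hcol j\<close> that is scaled.\<close>
  have obj: "1 \<bullet> (\<chi> j. c $ j * x $ j) = c \<bullet> x" for c x :: "real ^ 'n"
    by (simp add: inner_vec_def)
  have con: "(\<chi> i j. A $ i $ j * x $ j) *v 1 = A *v x" for A :: "real ^ 'n ^ 'm" and x
    by (simp add: matrix_vector_mult_def)
  have col: "((\<chi> j. c $ j * x $ j) $ j, column j (\<chi> i j. A $ i $ j * x $ j))
      = x $ j *\<^sub>R (c $ j, column j A)" for c x :: "real ^ 'n" and A :: "real ^ 'n ^ 'm" and j
    by (simp add: column_def vec_eq_iff)
  show ?thesis
  proof (intro equalityI subsetI)
    fix p assume "p \<in> var_transform ` rcep_feasible \<alpha> chat xhat D H"
    then obtain x c A b where "(x, c, A, b) \<in> rcep_feasible \<alpha> chat xhat D H"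
      and p: "p = (x, \<chi> j. c $ j * x $ j, \<chi> i j. A $ i $ j * x $ j, b)"
      by (auto simp: var_transform_def)
    then show "p \<in> transformed_region \<alpha> chat xhat D Hcol Hrhs"
      unfolding p transformed_region_def rcep_feasible_def mem_Collect_eq case_prod_conv obj con col H
      by blast
  next
    fix p assume p: "p \<in> transformed_region \<alpha> chat xhat D Hcol Hrhs"
    obtain x w U b where p_eq: "p = (x, w, U, b)"
      by (cases p)
    have "\<forall>j. \<exists>h\<in>Hcol j. (w $ j, column j U) = x $ j *\<^sub>R h"
      using p by (auto simp: p_eq transformed_region_def)
    \<comment> \<open>Choosing \<open>h j\<close> from the image, instead of dividing by
      \<open>x $ j\<close>, treats zero and positive \<open>x $ j\<close> alike.\<close>
    then obtain h where h: "\<And>j. h j \<in> Hcol j" "\<And>j. (w $ j, column j U) = x $ j *\<^sub>R h j"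
      by metis
    \<comment> \<open>The chosen \<open>h j\<close> become the columns of the preimage; the product
      form of \<open>H\<close> then puts \<open>(c, A, b)\<close> into \<open>H\<close>.\<close>
    define c where "c = (\<chi> j. fst (h j))"
    define A where "A = (\<chi> i j. snd (h j) $ i)"
    have hj: "(c $ j, column j A) = h j" for j
      by (simp add: c_def A_def column_def prod_eq_iff)
    have w: "w = (\<chi> j. c $ j * x $ j)" and U: "U = (\<chi> i j. A $ i $ j * x $ j)"
      using h(2) by (auto simp: c_def A_def column_def vec_eq_iff prod_eq_iff mult.commute)
    have "(x, c, A, b) \<in> rcep_feasible \<alpha> chat xhat D H"
      using p h(1) by (auto simp: p_eq transformed_region_def rcep_feasible_def H hj w U obj con)
    then show "p \<in> var_transform ` rcep_feasible \<alpha> chat xhat D H"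
      by (rule rev_image_eqI) (simp add: var_transform_def p_eq w U)
  qed
qed

theorem theorem3p4:
  fixes chat xhat :: "real ^ 'n" and Ahat :: "real ^ 'n ^ 'm" and bhat :: "real ^ 'm"
    and H :: "('n, 'm) params set"
    and Hcol :: "'n \<Rightarrow> (real \<times> (real ^ 'm)) set" and Hrhs :: "(real ^ 'm) set"
    and D :: "real ^ 'n \<Rightarrow> (real ^ 'n) set" and \<alpha> :: real
  assumes "lp_optimal chat Ahat bhat xhat"
    and "chat \<bullet> xhat \<ge> 0"
    and "(chat, Ahat, bhat) \<in> H"
    and "\<alpha> \<ge> 0"
    and "compact H" and "convex H" and "columnwise H Hcol Hrhs"
    and "compact (D xhat)" and "convex (D xhat)"
  shows "convex (var_transform ` rcep_feasible \<alpha> chat xhat D H)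
    \<and> var_transform ` rcep_feasible \<alpha> chat xhat D H
        = transformed_region \<alpha> chat xhat D Hcol Hrhs"
proof -
  have "\<And>j. convex (Hcol j)" and "convex Hrhs"
    using assms(7) by (auto simp: columnwise_def)
  \<comment> \<open>The feasible region is described by bilinear constraints, so convexity is not
    sought there: the equality carries it over from \<open>transformed_region\<close>.\<close>
  then show ?thesis
    using convex_transformed_region[where D = D and xhat = xhat, OF assms(9)] var_transform_rcep_feasible[OF assms(7)]
    by metis
qed

end
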